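(* Let $G=(V,E)$ be a connected simple graph with at least two vertices. Then for every vertex $v_i\in V$, $$\mathcal{RE}_G(v_i)\leq\sqrt{\frac{1}{d_i}\sum_{j:\, v_j\sim v_i}\frac{1}{d_j}},$$ and equality holds if and only if $G$ is a star graph with $v_i$ being the center of the star.
   Context: All graphs are finite and simple. For a graph $G$ with vertices $v_1,\dots,v_n$, let $d_i$ be the degree of $v_i$; $v_j\sim v_i$ means that $v_j$ and $v_i$ are adjacent. The Randić matrix $R(G)=(R_{ij})$ is the real symmetric $n\times n$ matrix with $R_{ij}=\frac{1}{\sqrt{d_id_j}}$ if $v_i\sim v_j$ and $R_{ij}=0$ otherwise. Put $|R(G)|=(R(G)R(G)^* )^{1/2}$ (positive semidefinite square root). The Randić energy of the vertex $v_i$ is $\mathcal{RE}_G(v_i)=|R(G)|_{ii}$, the $i$-th diagonal entry of $|R(G)|$. The star graph on $n\ge 2$ vertices is $S_n=K_{1,n-1}$; its center is the vertex adjacent to all others (for $n=2$, either vertex). *)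

theory Defs
  imports
    Complex_Main
    "Graph_Theory.Graph_Theory"
    "Jordan_Normal_Form.Matrix"
    "Jordan_Normal_Form.Schur_Decomposition"
begin

text \<open>
  A finite simple graph is a \<^locale>\<open>pair_graph\<close>: every undirected edge is represented by the two
  arcs joining its endpoints, so the degree of a vertex is its out-degree.
\<close>

abbreviation adjacent :: "'a pair_pre_digraph \<Rightarrow> 'a \<Rightarrow> 'a \<Rightarrow> bool" where
  "adjacent G u v \<equiv> u \<rightarrow>\<^bsub>with_proj G\<^esub> v"

abbreviation degree_of :: "'a pair_pre_digraph \<Rightarrow> 'a \<Rightarrow> nat" where
  "degree_of G v \<equiv> out_degree (with_proj G) v"

text \<open>
  The list \<open>vs\<close> enumerates the vertices; entries are indexed from \<open>0\<close>.
\<close>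

definition randic_matrix :: "'a pair_pre_digraph \<Rightarrow> 'a list \<Rightarrow> real mat" where
  "randic_matrix G vs = mat (length vs) (length vs) (\<lambda>(i, j).
     if adjacent G (vs ! i) (vs ! j)
     then 1 / sqrt (real (degree_of G (vs ! i)) * real (degree_of G (vs ! j))) else 0)"

definition positive_semidefinite :: "real mat \<Rightarrow> bool" where
  "positive_semidefinite A \<longleftrightarrow> square_mat A \<and> transpose_mat A = A \<and>
     (\<forall>x \<in> carrier_vec (dim_row A). 0 \<le> x \<bullet> (A *\<^sub>v x))"

text \<open>
  For positive semidefinite \<open>A\<close> there is exactly one such \<open>B\<close>; it has the dimension of \<open>A\<close>,
  because \<open>B\<close> is square and \<open>B * B = A\<close>.
\<close>

definition psd_sqrt :: "real mat \<Rightarrow> real mat" where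
  "psd_sqrt A = (THE B. positive_semidefinite B \<and> B * B = A)"

definition mat_abs :: "real mat \<Rightarrow> real mat" where
  "mat_abs A = psd_sqrt (A * mat_adjoint A)"

definition randic_energy :: "'a pair_pre_digraph \<Rightarrow> 'a list \<Rightarrow> nat \<Rightarrow> real" where
  "randic_energy G vs i = mat_abs (randic_matrix G vs) $$ (i, i)"

definition star_graph :: "'a pair_pre_digraph \<Rightarrow> bool" where
  "star_graph G \<longleftrightarrow> card (pverts G) \<ge> 2 \<and>
     complete_bipartite_digraph 1 (card (pverts G) - 1) (with_proj G)"

definition star_center :: "'a pair_pre_digraph \<Rightarrow> 'a \<Rightarrow> bool" where
  "star_center G c \<longleftrightarrow> c \<in> pverts G \<and> (\<forall>v \<in> pverts G - {c}. adjacent G c v)"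

end

theory Submission
  imports Defs "HOL-Analysis.Function_Topology"
begin

text \<open>
  Write \<open>B = |R|\<close> for the positive semidefinite square root of \<open>R R\<^sup>T\<close>. Since \<open>B\<close> is symmetric,
  \<open>(R R\<^sup>T)\<^sub>i\<^sub>i = (B B)\<^sub>i\<^sub>i\<close> is the sum of the squares of the \<open>i\<close>-th column of \<open>B\<close>, and \<open>B\<^sub>i\<^sub>i\<^sup>2\<close> is one
  of these squares. This is the inequality, because \<open>(R R\<^sup>T)\<^sub>i\<^sub>i\<close> is the sum of
  \<open>1 / (d\<^sub>i d\<^sub>j)\<close> over the neighbours \<open>j\<close> of \<open>i\<close>. Equality means that the rest of that column is
  \<open>0\<close>, that is, the unit vector \<open>e\<^sub>i\<close> is an eigenvector of \<open>B\<close>. A positive semidefinite matrix and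
  its square have the same eigenvectors, so the condition is that \<open>e\<^sub>i\<close> is an eigenvector of
  \<open>R R\<^sup>T\<close>: its entries \<open>(j, i)\<close> with \<open>j \<noteq> i\<close> vanish (\<open>mat_abs_diagonal\<close>). All entries of
  \<open>R\<close> are nonnegative, so this entry vanishes exactly when \<open>i\<close> and \<open>j\<close> have no common neighbour.
  Then every neighbour of \<open>i\<close> is a leaf, and a connected graph with this property is a star centred
  at \<open>i\<close> (\<open>star_iff_no_common_neighbour\<close>).

  The square root is given by a definite description, so its existence and uniqueness are needed.
  Neither proof diagonalises a matrix. For existence, consider all \<open>M\<close> with
  \<open>M\<^sup>T M = R R\<^sup>T\<close>; they form a compact set, which is stable under multiplication by orthogonal matrices
  from the left. Let \<open>M\<close> have the largest trace. A Householder reflection cannot increase the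
  trace, which says that the quadratic form of \<open>M\<close> is nonnegative; a plane rotation cannot
  increase it, which says that \<open>M\<close> is symmetric. Hence \<open>M\<close> is positive semidefinite and
  \<open>M M = M\<^sup>T M = R R\<^sup>T\<close>. For uniqueness, let \<open>B\<close> and \<open>C\<close> be two square roots and \<open>D = B - C\<close>. Then
  \<open>B D = - D C\<close>, so the traces of \<open>D B D\<close> and of \<open>D C D\<close> are nonnegative numbers with sum \<open>0\<close>. This forces
  \<open>B D = D C = 0\<close>, and then \<open>D D = 0\<close> and \<open>D = 0\<close>.
\<close>

section \<open>Matrices of maximal trace with a given Gram matrix\<close>

text \<open>
  Matrices are functions on index pairs in this part, because the function space carries the
  product topology; an \<open>n \<times> n\<close> matrix is the restriction to indices below \<open>n\<close>.
\<close>

definition gram :: "nat \<Rightarrow> (nat \<times> nat \<Rightarrow> real) \<Rightarrow> nat \<Rightarrow> nat \<Rightarrow> real" where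
  "gram n M a b = (\<Sum>k<n. M (k, a) * M (k, b))"

definition same_gram :: "nat \<Rightarrow> (nat \<times> nat \<Rightarrow> real) \<Rightarrow> (nat \<times> nat \<Rightarrow> real) \<Rightarrow> bool" where
  "same_gram n M N \<longleftrightarrow> (\<forall>a<n. \<forall>b<n. gram n M a b = gram n N a b)"

definition tr :: "nat \<Rightarrow> (nat \<times> nat \<Rightarrow> real) \<Rightarrow> real" where
  "tr n M = (\<Sum>k<n. M (k, k))"

text \<open>
  Tychonoff's theorem, for a product of compact sets indexed by a whole type.
\<close>

lemma compact_product:
  fixes K :: "'i \<Rightarrow> real set"
  assumes "\<And>p. compact (K p)"
  shows "compact {f. \<forall>p. f p \<in> K p}"
proof -
  have "compactin (product_topology (\<lambda>_. euclidean) UNIV) (PiE UNIV K)"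
    unfolding compactin_PiE using assms by simp
  moreover have "PiE UNIV K = {f. \<forall>p. f p \<in> K p}" by (auto simp: PiE_def Pi_def)
  ultimately show ?thesis by (simp add: euclidean_product_topology)
qed

text \<open>
  The diagonal of the Gram matrix bounds every entry of \<open>M\<close>, and the Gram condition is closed.
  Entries outside the \<open>n \<times> n\<close> square are unconstrained, so compactness holds only after
  they are set to \<open>0\<close>, which changes neither the trace nor the Gram matrix.
\<close>

lemma trace_maximizer_exists:
  obtains M where "same_gram n M N" "\<And>M'. same_gram n M' N \<Longrightarrow> tr n M' \<le> tr n M"
proof -
  define c where "c = 1 + (\<Sum>a<n. gram n N a a)"
  define K where "K p = (if p \<in> {..<n} \<times> {..<n} then {-c..c} else {0::real})" for p :: "nat \<times> nat"
  define S where "S = {f. \<forall>p. f p \<in> K p} \<inter> {M. \<forall>a b. a < n \<longrightarrow> b < n \<longrightarrow> gram n M a b = gram n N a b}"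
  have cont: "continuous_on UNIV (\<lambda>M. M p)" for p :: "nat \<times> nat"
    by (rule continuous_on_product_coordinates)
  have "closed {M. \<forall>a b. a < n \<longrightarrow> b < n \<longrightarrow> gram n M a b = gram n N a b}"
    unfolding gram_def
    by (intro closed_Collect_all closed_Collect_imp open_Collect_const closed_Collect_eq continuous_on_sum continuous_on_mult continuous_on_const cont)
  then have "compact S"
    unfolding S_def by (intro compact_Int_closed compact_product) (auto simp: K_def)
  have gram_nonneg: "0 \<le> gram n N a a" for a
    unfolding gram_def by (intro sum_nonneg) auto
  define trunc where "trunc M p = (if p \<in> {..<n} \<times> {..<n} then M p else 0)" for M :: "nat \<times> nat \<Rightarrow> real" and p
  have in_S: "trunc M \<in> S" if "same_gram n M N" for M
  proof -
    have "\<bar>M (k, a)\<bar> \<le> c" if ka: "k < n" "a < n" for k a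
    proof -
      have "\<bar>M (k, a)\<bar> \<le> 1 + M (k, a) * M (k, a)"
      proof (cases "\<bar>M (k, a)\<bar> \<le> 1")
        case True
        then show ?thesis by (smt (verit) zero_le_square)
      next
        case False
        then have "\<bar>M (k, a)\<bar> * 1 \<le> \<bar>M (k, a)\<bar> * \<bar>M (k, a)\<bar>" by (intro mult_left_mono) auto
        then show ?thesis by (simp add: abs_mult_self_eq)
      qed
      also have "M (k, a) * M (k, a) \<le> gram n M a a"
        unfolding gram_def using ka by (intro member_le_sum[where f="\<lambda>k. M (k,a) * M (k,a)"]) auto
      also have "gram n M a a = gram n N a a" using \<open>same_gram n M N\<close> ka by (simp add: same_gram_def)
      also have "gram n N a a \<le> (\<Sum>a<n. gram n N a a)"
        using ka gram_nonneg by (intro member_le_sum) auto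
      finally show ?thesis by (simp add: c_def)
    qed
    then have "trunc M p \<in> K p" for p by (cases p) (auto simp: trunc_def K_def abs_le_iff minus_le_iff)
    moreover have "gram n (trunc M) a b = gram n M a b" if "a < n" "b < n" for a b
      using that by (auto simp: gram_def trunc_def intro!: sum.cong)
    ultimately show ?thesis using that by (auto simp: S_def same_gram_def)
  qed
  have tr_trunc: "tr n (trunc M) = tr n M" for M
    by (auto simp: tr_def trunc_def intro!: sum.cong)
  have "S \<noteq> {}" using in_S[of N] by (auto simp: same_gram_def)
  moreover have "continuous_on S (tr n)"
    unfolding tr_def by (rule continuous_on_subset[where s=UNIV]) (auto intro!: continuous_on_sum cont)
  ultimately obtain M where M: "M \<in> S" "\<And>M'. M' \<in> S \<Longrightarrow> tr n M' \<le> tr n M"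
    using continuous_attains_sup[OF \<open>compact S\<close>] by blast
  show thesis
  proof
    show "same_gram n M N" using M(1) by (auto simp: S_def same_gram_def)
    show "tr n M' \<le> tr n M" if "same_gram n M' N" for M'
      using M(2)[OF in_S[OF that]] tr_trunc by simp
  qed
qed

text \<open>
  The reflection in the hyperplane orthogonal to \<open>v\<close> preserves the Gram matrix and lowers the trace of
  \<open>M\<close> by \<open>2 / |v|\<^sup>2\<close> times the value of the quadratic form of \<open>M\<close> at \<open>v\<close>.
\<close>

lemma maximizer_nonneg_form:
  assumes max: "\<And>M'. same_gram n M' M \<Longrightarrow> tr n M' \<le> tr n M"
  shows "0 \<le> (\<Sum>k<n. v k * (\<Sum>l<n. M (k, l) * v l))"
proof -
  define s where "s = (\<Sum>k<n. v k * v k)"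
  show ?thesis
  proof (cases "s = 0")
    case True
    then have "v k = 0" if "k < n" for k
      using that by (simp add: s_def sum_nonneg_eq_0_iff)
    then show ?thesis by simp
  next
    case False
    moreover have "s \<ge> 0" unfolding s_def by (intro sum_nonneg) auto
    ultimately have "s > 0" by simp
    define w where "w a = (\<Sum>k<n. v k * M (k, a))" for a
    \<comment> \<open>\<open>H\<close> is the reflection applied to \<open>M\<close>, and \<open>w\<close> is the row vector \<open>v\<^sup>T M\<close>.\<close>
    define H where "H = (\<lambda>(k, a). M (k, a) - 2 / s * (v k * w a))"
    have "gram n H a b = gram n M a b" for a b
    proof -
      have "gram n H a b = (\<Sum>k<n. M (k,a) * M (k,b) - (2 / s * w a) * (v k * M (k,b))
          - (2 / s * w b) * (v k * M (k,a)) + (4 / (s * s) * w a * w b) * (v k * v k))"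
        unfolding gram_def H_def by (intro sum.cong) (auto simp: algebra_simps)
      also have "\<dots> = gram n M a b - (2 / s * w a) * w b - (2 / s * w b) * w a
          + (4 / (s * s) * w a * w b) * s"
        unfolding sum.distrib sum_subtractf sum_distrib_left[symmetric] gram_def w_def s_def ..
      also have "\<dots> = gram n M a b" using \<open>s > 0\<close> by (simp add: field_simps)
      finally show ?thesis .
    qed
    then have "tr n H \<le> tr n M" by (intro max) (simp add: same_gram_def)
    moreover have "tr n H = tr n M - 2 / s * (\<Sum>k<n. v k * w k)"
      unfolding tr_def H_def by (simp add: sum_subtractf sum_distrib_left)
    ultimately have "0 \<le> (\<Sum>k<n. v k * w k)" using \<open>s > 0\<close> by (simp add: zero_le_mult_iff zero_le_divide_iff)
    also have "\<dots> = (\<Sum>k<n. v k * (\<Sum>l<n. M (k, l) * v l))"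
      unfolding w_def sum_distrib_left by (subst sum.swap) (simp add: mult_ac)
    finally show ?thesis .
  qed
qed

text \<open>
  Rotating the rows \<open>i\<close> and \<open>j\<close> preserves the Gram matrix. For a small angle the trace changes to
  first order by the angle times \<open>M\<^sub>j\<^sub>i - M\<^sub>i\<^sub>j\<close>, so this difference must vanish at a maximum.
\<close>

lemma maximizer_symmetric:
  assumes max: "\<And>M'. same_gram n M' M \<Longrightarrow> tr n M' \<le> tr n M"
    and ij: "i < n" "j < n"
  shows "M (i, j) = M (j, i)"
proof (cases "i = j")
  case False
  define x where "x = M (i, i) + M (j, j)"
  define y where "y = M (j, i) - M (i, j)"
  have split_sum: "(\<Sum>k<n. f k) = f i + f j + (\<Sum>k\<in>{..<n} - {i} - {j}. f k)" for f :: "nat \<Rightarrow> real"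
    using ij False by (simp add: sum.remove[of "{..<n}" i] sum.remove[of "{..<n} - {i}" j])
  have rot: "(c - 1) * x + s * y \<le> 0" if cs: "c * c + s * s = 1" for c s
  proof -
    define Q where "Q = (\<lambda>(k, a). if k = i then c * M (i, a) + s * M (j, a)
        else if k = j then c * M (j, a) - s * M (i, a) else M (k, a))"
    have "gram n Q a b = gram n M a b" for a b
    proof -
      have "Q (i,a) * Q (i,b) + Q (j,a) * Q (j,b)
          = (c * c + s * s) * (M (i,a) * M (i,b) + M (j,a) * M (j,b))"
        using False by (simp add: Q_def algebra_simps)
      moreover have "(\<Sum>k\<in>{..<n} - {i} - {j}. Q (k,a) * Q (k,b)) = (\<Sum>k\<in>{..<n} - {i} - {j}. M (k,a) * M (k,b))"
        by (intro sum.cong) (auto simp: Q_def)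
      ultimately show ?thesis unfolding gram_def split_sum using cs by simp
    qed
    then have "tr n Q \<le> tr n M" by (intro max) (simp add: same_gram_def)
    moreover have "(\<Sum>k\<in>{..<n} - {i} - {j}. Q (k,k)) = (\<Sum>k\<in>{..<n} - {i} - {j}. M (k,k))"
      by (intro sum.cong) (auto simp: Q_def)
    ultimately show ?thesis unfolding tr_def split_sum using False
      by (simp add: Q_def x_def y_def algebra_simps)
  qed
  have x: "0 \<le> x"
    using rot[of "-1" 0] by simp
  \<comment> \<open>The points \<open>((1 - t\<^sup>2) / (1 + t\<^sup>2), 2 t / (1 + t\<^sup>2))\<close> lie on the unit circle, and \<open>rot\<close> then reads
      \<open>t y \<le> t\<^sup>2 x\<close>. With \<open>y = t (x + 1)\<close> this becomes \<open>t\<^sup>2 \<le> 0\<close>.\<close>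
  define t where "t = y / (x + 1)"
  have pos: "1 + t * t > 0" by (smt (verit) zero_le_square)
  have "((1 - t * t) / (1 + t * t)) * ((1 - t * t) / (1 + t * t)) + (2 * t / (1 + t * t)) * (2 * t / (1 + t * t))
      = ((1 - t * t) * (1 - t * t) + (2 * t) * (2 * t)) / ((1 + t * t) * (1 + t * t))"
    by (simp only: times_divide_times_eq add_divide_distrib)
  also have "(1 - t * t) * (1 - t * t) + (2 * t) * (2 * t) = (1 + t * t) * (1 + t * t)"
    by (simp add: algebra_simps)
  finally have "((1 - t * t) / (1 + t * t) - 1) * x + (2 * t / (1 + t * t)) * y \<le> 0"
    using pos by (intro rot) simp
  moreover have c: "(1 - t * t) / (1 + t * t) - 1 = - (2 * t * t) / (1 + t * t)"
    using pos by (simp add: field_simps)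
  have "((1 - t * t) / (1 + t * t) - 1) * x + (2 * t / (1 + t * t)) * y
      = 2 * (t * y - t * t * x) / (1 + t * t)"
    unfolding c times_divide_eq_left add_divide_distrib[symmetric] by (simp add: algebra_simps)
  ultimately have "t * y - t * t * x \<le> 0"
    using pos by (simp add: divide_le_0_iff)
  moreover have "y = t * (x + 1)" using x by (simp add: t_def)
  ultimately have "t * t \<le> 0" by (simp add: algebra_simps)
  then have "t = 0" by (smt (verit) mult_eq_0_iff zero_le_square)
  then show ?thesis using \<open>y = t * (x + 1)\<close> by (simp add: y_def)
qed simp

section \<open>Positive semidefinite square roots\<close>

lemma positive_semidefiniteD:
  assumes "positive_semidefinite B" "B \<in> carrier_mat n n"
  shows "transpose_mat B = B" "x \<in> carrier_vec n \<Longrightarrow> 0 \<le> x \<bullet> (B *\<^sub>v x)"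
  using assms by (auto simp: positive_semidefinite_def)

lemma scalar_prod_self_nonneg: "0 \<le> (x :: real vec) \<bullet> x"
  by (auto simp: scalar_prod_def intro!: sum_nonneg)

lemma scalar_prod_self_eq_0:
  assumes "(x :: real vec) \<in> carrier_vec n" "x \<bullet> x = 0"
  shows "x = 0\<^sub>v n"
  using assms by (intro eq_vecI) (auto simp: scalar_prod_def sum_nonneg_eq_0_iff)

lemma symmetric_scalar_prod:
  fixes B :: "real mat"
  assumes "B \<in> carrier_mat n n" "transpose_mat B = B" "x \<in> carrier_vec n" "y \<in> carrier_vec n"
  shows "(B *\<^sub>v x) \<bullet> y = x \<bullet> (B *\<^sub>v y)"
  using transpose_vec_mult_scalar[of B n n y x] assms by simp

text \<open>
  The form is nonnegative along the line \<open>x + t (B x)\<close> and vanishes at \<open>t = 0\<close>, so its derivative there,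
  \<open>2 |B x|\<^sup>2\<close>, is \<open>0\<close>.
\<close>

lemma positive_semidefinite_form_eq_0:
  assumes psd: "positive_semidefinite B" and B: "B \<in> carrier_mat n n"
    and x: "x \<in> carrier_vec n" and form: "x \<bullet> (B *\<^sub>v x) = 0"
  shows "B *\<^sub>v x = 0\<^sub>v n"
proof -
  define y where "y = B *\<^sub>v x"
  define a where "a = y \<bullet> y"
  define q where "q = y \<bullet> (B *\<^sub>v y)"
  \<comment> \<open>Adding \<open>1\<close> to the denominator covers \<open>q = 0\<close>; this \<open>t\<close> still makes the form negative unless \<open>a = 0\<close>.\<close>
  define t where "t = - a / (q + 1)"
  have y: "y \<in> carrier_vec n" using B x by (simp add: y_def)
  have q: "0 \<le> q" unfolding q_def by (rule positive_semidefiniteD(2)[OF psd B y])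
  have xBy: "x \<bullet> (B *\<^sub>v y) = a"
    using symmetric_scalar_prod[OF B positive_semidefiniteD(1)[OF psd B] x y] by (simp add: a_def y_def)
  have "0 \<le> (x + t \<cdot>\<^sub>v y) \<bullet> (B *\<^sub>v (x + t \<cdot>\<^sub>v y))"
    using x y by (intro positive_semidefiniteD(2)[OF psd B]) simp
  also have "B *\<^sub>v (x + t \<cdot>\<^sub>v y) = y + t \<cdot>\<^sub>v (B *\<^sub>v y)"
    using B x y by (simp add: mult_add_distrib_mat_vec[OF B x] mult_mat_vec[OF B] y_def)
  also have "(x + t \<cdot>\<^sub>v y) \<bullet> (y + t \<cdot>\<^sub>v (B *\<^sub>v y)) = x \<bullet> y + t * (x \<bullet> (B *\<^sub>v y)) + t * (y \<bullet> y) + t * (t * (y \<bullet> (B *\<^sub>v y)))"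
    using B x y by (simp add: add_scalar_prod_distrib[of _ n] scalar_prod_add_distrib[of _ n] distrib_left)
  also have "\<dots> = 2 * t * a + t * t * q"
    using form xBy by (simp add: y_def[symmetric]) (simp add: a_def q_def)
  finally have *: "0 \<le> 2 * t * a + t * t * q" .
  have a: "a = - t * (q + 1)" using q by (simp add: t_def)
  have "t * t * (q + 2) \<le> 0" using * unfolding a by (simp add: algebra_simps)
  then have "t * t \<le> 0" using q by (simp add: mult_le_0_iff)
  then have "t = 0" by (smt (verit) mult_eq_0_iff zero_le_square)
  then have "y \<bullet> y = 0" using a by (simp add: a_def)
  then show ?thesis using scalar_prod_self_eq_0[OF y] by (simp add: y_def)
qed

text \<open>
  The vector \<open>y = B x - d x\<close> satisfies \<open>B y = - d y\<close>, and for \<open>d > 0\<close> a positive semidefinite matrix has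
  no eigenvalue \<open>- d\<close>. For \<open>d = 0\<close> this says nothing, but then \<open>|B x|\<^sup>2 = x \<bullet> B (B x) = 0\<close>.
\<close>

lemma positive_semidefinite_eigenvector_of_square:
  assumes psd: "positive_semidefinite B" and B: "B \<in> carrier_mat n n"
    and x: "x \<in> carrier_vec n" and d: "0 \<le> d" and sq: "B *\<^sub>v (B *\<^sub>v x) = (d * d) \<cdot>\<^sub>v x"
  shows "B *\<^sub>v x = d \<cdot>\<^sub>v x"
proof (cases "d = 0")
  case True
  have "(B *\<^sub>v x) \<bullet> (B *\<^sub>v x) = x \<bullet> (B *\<^sub>v (B *\<^sub>v x))"
    using B x by (intro symmetric_scalar_prod[OF B positive_semidefiniteD(1)[OF psd B]]) auto
  also have "\<dots> = 0" using True x by (simp add: sq)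
  finally have "B *\<^sub>v x = 0\<^sub>v n" using B x by (intro scalar_prod_self_eq_0) auto
  then show ?thesis using True x by auto
next
  case False
  define y where "y = B *\<^sub>v x - d \<cdot>\<^sub>v x"
  have y: "y \<in> carrier_vec n" using B x by (simp add: y_def)
  have By: "B *\<^sub>v y = (- d) \<cdot>\<^sub>v y"
    unfolding y_def using B x
    by (simp add: mult_minus_distrib_mat_vec[OF B] mult_mat_vec[OF B] sq) (auto simp: algebra_simps)
  have "0 \<le> y \<bullet> (B *\<^sub>v y)" by (rule positive_semidefiniteD(2)[OF psd B y])
  also have "\<dots> = - d * (y \<bullet> y)" using y by (simp add: By)
  finally have "y \<bullet> y = 0" using d False scalar_prod_self_nonneg[of y]
    by (smt (verit) mult_pos_pos mult_minus_left)
  then have "y = 0\<^sub>v n" by (rule scalar_prod_self_eq_0[OF y])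
  then show ?thesis using B x unfolding y_def
    by (intro eq_vecI) (auto dest: arg_cong[where f="\<lambda>v. v $ _"] simp: vec_eq_iff)
qed

text \<open>
  With \<open>D = B - C\<close>, the identity \<open>B D = - D C\<close> gives \<open>tr (D B D) = - tr (D D C) = - tr (D C D)\<close>. Both
  traces are sums of values of nonnegative forms at the columns of \<open>D\<close>, so all these values vanish
  and \<open>B D = 0\<close>.
\<close>

lemma positive_semidefinite_sqrt_unique:
  assumes psd: "positive_semidefinite B" "positive_semidefinite C"
    and B: "B \<in> carrier_mat n n" and C: "C \<in> carrier_mat n n" and eq: "B * B = C * C"
  shows "B = C"
proof -
  define D where "D = B - C"
  have D: "D \<in> carrier_mat n n" unfolding D_def by (rule minus_carrier_mat[OF C])
  note symB = positive_semidefiniteD(1)[OF psd(1) B] and symC = positive_semidefiniteD(1)[OF psd(2) C]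
  have symD: "transpose_mat D = D"
    using B C symB symC by (simp add: D_def transpose_minus)
  have BD: "B * D = - (D * C)"
    using B C eq unfolding D_def
    by (simp add: mult_minus_distrib_mat[OF B B C] minus_mult_distrib_mat[OF B C C]) (auto simp: carrier_matD)
  have entryBD: "(B * D) $$ (k, j) = (B *\<^sub>v col D j) $ k" if "k < n" "j < n" for k j
    using that B D by simp
  have rowcol: "row D k = col D k" if "k < n" for k
    using that D symD by (metis carrier_matD(2) row_transpose)
  have entryDC: "(D * C) $$ (k, j) = (C *\<^sub>v col D k) $ j" if "k < n" "j < n" for k j
  proof -
    have "row C j = col C j" using that C symC by (metis carrier_matD(2) row_transpose)
    then show ?thesis using that C D rowcol[OF that(1)] by (simp add: comm_scalar_prod[of _ n])
  qed
  \<comment> \<open>\<open>?T X\<close> is the trace of \<open>D X\<close>.\<close>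
  let ?T = "\<lambda>X. \<Sum>k<n. \<Sum>j<n. D $$ (k, j) * X $$ (k, j)"
  have colD: "col D j \<in> carrier_vec n" for j by (rule carrier_vecI) (use D in simp)
  have Dsym: "D $$ (k, j) = D $$ (j, k)" if "k < n" "j < n" for k j
    using that D symD by (metis carrier_matD index_transpose_mat(1))
  have "?T (B * D) = (\<Sum>j<n. \<Sum>k<n. D $$ (k, j) * (B * D) $$ (k, j))"
    by (rule sum.swap)
  also have "\<dots> = (\<Sum>j<n. col D j \<bullet> (B *\<^sub>v col D j))"
    using B D by (intro sum.cong) (auto simp: scalar_prod_def[of "col D _" "B *\<^sub>v _"] entryBD atLeast0LessThan simp del: index_mult_mat_vec index_mult_mat(1))
  finally have TB: "?T (B * D) = (\<Sum>j<n. col D j \<bullet> (B *\<^sub>v col D j))" .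
  have TC: "?T (D * C) = (\<Sum>k<n. col D k \<bullet> (C *\<^sub>v col D k))"
    using C D by (intro sum.cong) (auto simp: scalar_prod_def[of "col D _" "C *\<^sub>v _"] entryDC Dsym atLeast0LessThan simp del: index_mult_mat_vec index_mult_mat(1) intro!: sum.cong)
  have "?T (B * D) = - ?T (D * C)"
    using C D unfolding BD by (simp add: sum_negf del: index_mult_mat(1))
  moreover have posB: "0 \<le> col D j \<bullet> (B *\<^sub>v col D j)" for j
    by (rule positive_semidefiniteD(2)[OF psd(1) B colD])
  moreover have "0 \<le> col D k \<bullet> (C *\<^sub>v col D k)" for k
    by (rule positive_semidefiniteD(2)[OF psd(2) C colD])
  then have "0 \<le> ?T (D * C)" unfolding TC by (intro sum_nonneg) auto
  ultimately have "(\<Sum>j<n. col D j \<bullet> (B *\<^sub>v col D j)) \<le> 0" using TB by simp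
  then have "(\<Sum>j<n. col D j \<bullet> (B *\<^sub>v col D j)) = 0"
    using posB by (meson antisym sum_nonneg)
  then have "col D j \<bullet> (B *\<^sub>v col D j) = 0" if "j < n" for j
    using that posB by (simp add: sum_nonneg_eq_0_iff)
  then have "B *\<^sub>v col D j = 0\<^sub>v n" if "j < n" for j
    using that positive_semidefinite_form_eq_0[OF psd(1) B colD] by blast
  then have BD0: "B * D = 0\<^sub>m n n"
    using B D entryBD by (intro eq_matI) (auto simp del: index_mult_mat(1))
  have DC0: "D * C = 0\<^sub>m n n"
    using arg_cong[OF BD, of "\<lambda>X. - X"] D C unfolding BD0 by (auto intro!: eq_matI simp: mat_eq_iff)
  have "D * B = transpose_mat (B * D)" using B D symB symD by (simp add: transpose_mult)
  then have "D * B = 0\<^sub>m n n" by (simp add: BD0)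
  then have "D * D = 0\<^sub>m n n"
    using B C D DC0 mult_minus_distrib_mat[OF D B C] by (simp add: D_def[symmetric]) 
  then have "col D i \<bullet> col D i = 0" if "i < n" for i
    using that D rowcol[OF that] by (metis carrier_matD index_mult_mat(1) index_zero_mat(1))
  then have "col D i = 0\<^sub>v n" if "i < n" for i
    using that scalar_prod_self_eq_0[OF colD] by blast
  then have "D $$ (k, i) = 0" if "k < n" "i < n" for k i
    using that D by (metis carrier_matD index_col index_zero_vec(1))
  then have "B $$ (k, i) = C $$ (k, i)" if "k < n" "i < n" for k i
    using that B C by (simp add: D_def)
  then show ?thesis using B C by (intro eq_matI) auto
qed

lemma mat_adjoint_real:
  fixes R :: "real mat"
  assumes "R \<in> carrier_mat n m"
  shows "mat_adjoint R = transpose_mat R"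
  using assms by (intro eq_matI) (auto simp: mat_adjoint_def mat_of_rows_def)

text \<open>
  Here \<open>N\<close> is the transpose of \<open>R\<close>, so that its Gram matrix is \<open>R R\<^sup>T\<close>; the square root is the
  trace-maximal matrix with this Gram matrix.
\<close>

lemma positive_semidefinite_sqrt_exists:
  fixes R :: "real mat"
  assumes R: "R \<in> carrier_mat n n"
  obtains B where "B \<in> carrier_mat n n" "positive_semidefinite B" "B * B = R * transpose_mat R"
proof -
  define N where "N = (\<lambda>(k, a). R $$ (a, k))"
  obtain M where gram: "same_gram n M N" and "\<And>M'. same_gram n M' N \<Longrightarrow> tr n M' \<le> tr n M"
    using trace_maximizer_exists[of n N] by blast
  then have max: "\<And>M'. same_gram n M' M \<Longrightarrow> tr n M' \<le> tr n M"
    by (auto simp: same_gram_def)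
  note sym = maximizer_symmetric[OF max] and nonneg = maximizer_nonneg_form[OF max]
  define B where "B = mat n n M"
  have B: "B \<in> carrier_mat n n" by (simp add: B_def)
  moreover have "0 \<le> x \<bullet> (B *\<^sub>v x)" if "x \<in> carrier_vec n" for x
    using that nonneg[of "\<lambda>k. x $ k"] by (simp add: B_def scalar_prod_def atLeast0LessThan)
  then have "positive_semidefinite B"
    by (auto simp: positive_semidefinite_def B_def intro!: eq_matI sym)
  moreover have "B * B = R * transpose_mat R"
  proof (rule eq_matI)
    fix a b assume "a < dim_row (R * transpose_mat R)" "b < dim_col (R * transpose_mat R)"
    then have ab: "a < n" "b < n" using R by auto
    have "(B * B) $$ (a, b) = gram n M a b"
      using ab sym by (auto simp: B_def gram_def scalar_prod_def atLeast0LessThan intro!: sum.cong)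
    also have "\<dots> = gram n N a b" using gram ab by (simp add: same_gram_def)
    also have "\<dots> = (R * transpose_mat R) $$ (a, b)"
      using ab R by (auto simp: N_def gram_def scalar_prod_def atLeast0LessThan intro!: sum.cong)
    finally show "(B * B) $$ (a, b) = (R * transpose_mat R) $$ (a, b)" .
  qed (use R B in auto)
  ultimately show thesis by (rule that)
qed

text \<open>
  Everything that is used about the definite description behind \<^const>\<open>mat_abs\<close>.
\<close>

lemma mat_abs_properties:
  fixes R :: "real mat"
  assumes R: "R \<in> carrier_mat n n"
  shows "mat_abs R \<in> carrier_mat n n" "positive_semidefinite (mat_abs R)"
    "mat_abs R * mat_abs R = R * transpose_mat R"
proof -
  have dim: "B \<in> carrier_mat n n" if "positive_semidefinite B" "B * B = R * transpose_mat R" for B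
  proof -
    have "dim_row B = n" using arg_cong[OF that(2), of dim_row] R by simp
    then show ?thesis using that(1) by (auto simp: positive_semidefinite_def)
  qed
  have "\<exists>!B. positive_semidefinite B \<and> B * B = R * transpose_mat R"
  proof -
    obtain B where B: "B \<in> carrier_mat n n" "positive_semidefinite B" "B * B = R * transpose_mat R"
      by (rule positive_semidefinite_sqrt_exists[OF R])
    have "C = B" if C: "positive_semidefinite C" "C * C = R * transpose_mat R" for C
      by (rule positive_semidefinite_sqrt_unique[OF C(1) B(2) dim[OF C] B(1) trans[OF C(2) B(3)[symmetric]]])
    then show ?thesis using B(2,3) by blast
  qed
  from theI'[OF this] show "positive_semidefinite (mat_abs R)" "mat_abs R * mat_abs R = R * transpose_mat R"
    unfolding mat_abs_def psd_sqrt_def mat_adjoint_real[OF R] by blast+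
  then show "mat_abs R \<in> carrier_mat n n" by (rule dim)
qed

section \<open>The diagonal of the absolute value of a matrix\<close>

text \<open>
  The difference \<open>A\<^sub>i\<^sub>i - |R|\<^sub>i\<^sub>i\<^sup>2\<close> is the sum of the squares of the off-diagonal entries in column \<open>i\<close> of
  \<open>|R|\<close>. These entries vanish iff the \<open>i\<close>-th unit vector is an eigenvector of \<open>|R|\<close>, equivalently of
  \<open>A = |R|\<^sup>2\<close>.
\<close>

lemma mat_abs_diagonal:
  fixes R :: "real mat"
  assumes R: "R \<in> carrier_mat n n" and i: "i < n"
  defines "A \<equiv> R * transpose_mat R"
  shows "mat_abs R $$ (i, i) \<le> sqrt (A $$ (i, i))"
    and "mat_abs R $$ (i, i) = sqrt (A $$ (i, i)) \<longleftrightarrow> (\<forall>j<n. j \<noteq> i \<longrightarrow> A $$ (j, i) = 0)"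
proof -
  define B where "B = mat_abs R"
  have B: "B \<in> carrier_mat n n" and psd: "positive_semidefinite B" and BB: "B * B = A"
    using mat_abs_properties[OF R] by (auto simp: B_def A_def)
  have A: "A \<in> carrier_mat n n" using R by (simp add: A_def)
  have entry: "A $$ (j, i) = (\<Sum>k<n. B $$ (j, k) * B $$ (k, i))" if "j < n" for j
    using that i B unfolding BB[symmetric] by (simp add: scalar_prod_def atLeast0LessThan)
  have sym: "B $$ (j, k) = B $$ (k, j)" if "j < n" "k < n" for j k
    using that B positive_semidefiniteD(1)[OF psd B] by (metis carrier_matD index_transpose_mat(1))
  have diag: "A $$ (i, i) = B $$ (i, i) * B $$ (i, i) + (\<Sum>k\<in>{..<n} - {i}. B $$ (k, i) * B $$ (k, i))"
  proof -
    have "A $$ (i, i) = (\<Sum>k<n. B $$ (k, i) * B $$ (k, i))"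
      unfolding entry[OF i] using sym[OF i] by (intro sum.cong) (auto simp only: lessThan_iff)
    then show ?thesis using i by (simp only: sum.remove[of "{..<n}" i] finite_lessThan lessThan_iff)
  qed
  have rest: "0 \<le> (\<Sum>k\<in>{..<n} - {i}. B $$ (k, i) * B $$ (k, i))"
    by (intro sum_nonneg) auto
  then have Aii: "0 \<le> A $$ (i, i)" by (simp add: diag)
  show "mat_abs R $$ (i, i) \<le> sqrt (A $$ (i, i))"
    unfolding B_def[symmetric] using rest by (intro real_le_rsqrt) (simp add: diag power2_eq_square)
  show "mat_abs R $$ (i, i) = sqrt (A $$ (i, i)) \<longleftrightarrow> (\<forall>j<n. j \<noteq> i \<longrightarrow> A $$ (j, i) = 0)"
    unfolding B_def[symmetric]
  proof
    assume "B $$ (i, i) = sqrt (A $$ (i, i))"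
    then have "B $$ (i, i) * B $$ (i, i) = A $$ (i, i)"
      using Aii by simp
    then have "(\<Sum>k\<in>{..<n} - {i}. B $$ (k, i) * B $$ (k, i)) = 0" using diag by simp
    then have off: "B $$ (k, i) = 0" if "k < n" "k \<noteq> i" for k
      using that by (simp add: sum_nonneg_eq_0_iff)
    show "\<forall>j<n. j \<noteq> i \<longrightarrow> A $$ (j, i) = 0"
    proof (intro allI impI)
      fix j assume j: "j < n" "j \<noteq> i"
      have "B $$ (j, k) * B $$ (k, i) = 0" if "k < n" for k
        using off[OF that] off[OF j] by (cases "k = i") auto
      then show "A $$ (j, i) = 0" unfolding entry[OF j(1)] by (intro sum.neutral) auto
    qed
  next
    assume zero: "\<forall>j<n. j \<noteq> i \<longrightarrow> A $$ (j, i) = 0"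
    define d where "d = sqrt (A $$ (i, i))"
    have dd: "d * d = A $$ (i, i)" using Aii by (simp add: d_def)
    have "B *\<^sub>v (B *\<^sub>v unit_vec n i) = A *\<^sub>v unit_vec n i"
      unfolding BB[symmetric] by (rule assoc_mult_mat_vec[OF B B unit_vec_carrier, symmetric])
    also have "\<dots> = (d * d) \<cdot>\<^sub>v unit_vec n i"
      using A i zero by (intro eq_vecI) (auto simp: dd)
    finally have "B *\<^sub>v unit_vec n i = d \<cdot>\<^sub>v unit_vec n i"
      using Aii by (intro positive_semidefinite_eigenvector_of_square[OF psd B]) (auto simp: d_def)
    then have "(B *\<^sub>v unit_vec n i) $ i = d" using i by simp
    then show "B $$ (i, i) = sqrt (A $$ (i, i))" using B i by (simp add: d_def)
  qed
qed

section \<open>Common neighbours and stars\<close>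

lemma randic_matrix_square_entry:
  assumes "i < length vs" "j < length vs"
  shows "(randic_matrix G vs * transpose_mat (randic_matrix G vs)) $$ (j, i)
    = (\<Sum>k<length vs. if adjacent G (vs ! j) (vs ! k) \<and> adjacent G (vs ! i) (vs ! k)
         then 1 / (real (degree_of G (vs ! k)) * sqrt (real (degree_of G (vs ! j)) * real (degree_of G (vs ! i)))) else 0)"
  using assms
  by (auto simp: randic_matrix_def scalar_prod_def atLeast0LessThan real_sqrt_mult intro!: sum.cong)

lemma (in pair_graph) degree_of_pos:
  assumes "adjacent G u v"
  shows "0 < degree_of G u"
proof -
  have "(u, v) \<in> out_arcs (with_proj G) u" using assms by (simp add: out_arcs_def)
  then have "out_arcs (with_proj G) u \<noteq> {}" by blast
  then show ?thesis by (simp add: out_degree_def card_gt_0_iff finite_out_arcs)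
qed

text \<open>
  If \<open>c\<close> shares no neighbour with another vertex, then every neighbour of \<open>c\<close> is a leaf. So \<open>c\<close> and
  its neighbours form a set that no edge leaves, and by connectedness this is the whole graph.
  Conversely, in a star on two vertices \<open>c\<close> may lie in either part of the bipartition; otherwise it
  is the vertex of the singleton part.
\<close>

lemma (in pair_graph) star_iff_no_common_neighbour:
  assumes conn: "Digraph_Component.connected (with_proj G)"
    and two: "card (pverts G) \<ge> 2" and c: "c \<in> pverts G"
  shows "star_graph G \<and> star_center G c
    \<longleftrightarrow> (\<forall>u \<in> pverts G - {c}. \<not> (\<exists>k. adjacent G u k \<and> adjacent G c k))"
proof
  assume star: "star_graph G \<and> star_center G c"
  then obtain U V where UV: "pverts G = U \<union> V" "U \<inter> V = {}" "card U = 1" "parcs G = U \<times> V \<union> V \<times> U"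
    by (auto simp: star_graph_def complete_bipartite_digraph_pair_def)
  obtain z where z: "U = {z}" using UV(3) by (rule card_1_singletonE)
  have adj: "(c, v) \<in> parcs G" if "v \<in> pverts G" "v \<noteq> c" for v
    using star that by (auto simp: star_center_def)
  show "\<forall>u \<in> pverts G - {c}. \<not> (\<exists>k. adjacent G u k \<and> adjacent G c k)"
  proof (cases "c = z")
    case True
    then show ?thesis using UV z by auto
  next
    case False
    then have "V \<subseteq> {c}" using adj UV z c by fastforce
    then show ?thesis using UV z by auto
  qed
next
  assume no_common: "\<forall>u \<in> pverts G - {c}. \<not> (\<exists>k. adjacent G u k \<and> adjacent G c k)"
  have sym: "(v, u) \<in> parcs G" if "(u, v) \<in> parcs G" for u v
    using that sym_arcs by (auto simp: symmetric_def elim: symE)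
  have loopfree: "(u, u) \<notin> parcs G" for u using pair_no_loops[of "(u, u)"] by auto
  have leaf: "v = c" if "(c, k) \<in> parcs G" "(k, v) \<in> parcs G" for k v
    using no_common sym[OF that(2)] that in_arcsD1[of v k] by auto
  have reach: "v = c \<or> (c, v) \<in> parcs G" if "c \<rightarrow>\<^sup>*\<^bsub>with_proj G\<^esub> v" for v
    using that by (induction rule: reachable_induct) (use leaf in auto)
  have "strongly_connected (with_proj G)"
    using conn sym_arcs by (rule symmetric_connected_imp_strongly_connected[rotated])
  then have all: "(c, v) \<in> parcs G" if "v \<in> pverts G" "v \<noteq> c" for v
    using reach[of v] that c by (auto simp: strongly_connected_def)
  then have center: "star_center G c" using c by (auto simp: star_center_def)
  have "parcs G = {c} \<times> (pverts G - {c}) \<union> (pverts G - {c}) \<times> {c}"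
  proof -
    have "u = c \<or> v = c" if "(u, v) \<in> parcs G" for u v
      using leaf[OF all[OF in_arcsD1[OF that]] that] by blast
    then have "parcs G \<subseteq> {c} \<times> (pverts G - {c}) \<union> (pverts G - {c}) \<times> {c}"
      using loopfree by (auto dest: in_arcsD1 in_arcsD2)
    moreover have "{c} \<times> (pverts G - {c}) \<union> (pverts G - {c}) \<times> {c} \<subseteq> parcs G"
      using all sym by auto
    ultimately show ?thesis by (rule equalityI)
  qed
  moreover have "pverts G = {c} \<union> (pverts G - {c})" using c by blast
  moreover have "card (pverts G - {c}) = card (pverts G) - 1"
    using c pair_finite_verts by simp
  ultimately have "star_graph G"
    unfolding star_graph_def complete_bipartite_digraph_pair_def
    by (intro conjI exI[of _ "{c}"] exI[of _ "pverts G - {c}"] two pair_finite_verts) (assumption | simp)+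
  then show "star_graph G \<and> star_center G c" using center by simp
qed

section \<open>The Randic energy of a vertex\<close>

theorem theorem3p5:
  fixes G :: "'a pair_pre_digraph" and vs :: "'a list" and i :: nat
  assumes "pair_graph G"
    and "Digraph_Component.connected (with_proj G)"
    and "card (pverts G) \<ge> 2"
    and "distinct vs" and "set vs = pverts G"
    and "i < length vs"
  shows "randic_energy G vs i
           \<le> sqrt (1 / real (degree_of G (vs ! i)) *
               (\<Sum>j | j < length vs \<and> adjacent G (vs ! j) (vs ! i).
                  1 / real (degree_of G (vs ! j))))
       \<and> (randic_energy G vs i
             = sqrt (1 / real (degree_of G (vs ! i)) *
                 (\<Sum>j | j < length vs \<and> adjacent G (vs ! j) (vs ! i).
                    1 / real (degree_of G (vs ! j))))
           \<longleftrightarrow> star_graph G \<and> star_center G (vs ! i))"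
proof -
  interpret pair_graph G by fact
  define n where "n = length vs"
  define R where "R = randic_matrix G vs"
  let ?d = "\<lambda>j. real (degree_of G (vs ! j))"
  have R: "R \<in> carrier_mat n n" by (simp add: R_def n_def randic_matrix_def)
  have i: "i < n" using assms by (simp add: n_def)
  have sym: "adjacent G u v \<longleftrightarrow> adjacent G v u" for u v
    using sym_arcs by (auto simp: symmetric_def elim: symE)
  have entry: "(R * transpose_mat R) $$ (j, i) = (\<Sum>k<n. if adjacent G (vs ! j) (vs ! k) \<and> adjacent G (vs ! i) (vs ! k)
         then 1 / (?d k * sqrt (?d j * ?d i)) else 0)" if "j < n" for j
    using randic_matrix_square_entry[of i vs j G] i that by (simp add: R_def n_def)
  have "(R * transpose_mat R) $$ (i, i)
      = (\<Sum>k<n. if adjacent G (vs ! k) (vs ! i) then 1 / ?d i * (1 / ?d k) else 0)"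
    unfolding entry[OF i] by (intro sum.cong) (auto dest: iffD1[OF sym[simplified]])
  also have "\<dots> = (\<Sum>k | k < n \<and> adjacent G (vs ! k) (vs ! i). 1 / ?d i * (1 / ?d k))"
    by (simp add: sum.inter_filter[symmetric])
  finally have diag: "(R * transpose_mat R) $$ (i, i)
      = 1 / ?d i * (\<Sum>k | k < n \<and> adjacent G (vs ! k) (vs ! i). 1 / ?d k)"
    by (simp only: sum_distrib_left)
  have offdiag: "(R * transpose_mat R) $$ (j, i) = 0
      \<longleftrightarrow> \<not> (\<exists>k. adjacent G (vs ! j) k \<and> adjacent G (vs ! i) k)" if "j < n" for j
  proof -
    have "(R * transpose_mat R) $$ (j, i) = 0
        \<longleftrightarrow> (\<forall>k<n. \<not> (adjacent G (vs ! j) (vs ! k) \<and> adjacent G (vs ! i) (vs ! k)))"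
    proof -
      \<comment> \<open>A missing edge contributes \<open>0\<close>; every other summand is positive because an endpoint of an edge
          has positive degree, so nothing cancels.\<close>
      have pos: "0 < 1 / (?d k * sqrt (?d j * ?d i))"
        if "adjacent G (vs ! j) (vs ! k)" "adjacent G (vs ! i) (vs ! k)" for k
        using degree_of_pos[of "vs ! j" "vs ! k"] degree_of_pos[of "vs ! i" "vs ! k"] degree_of_pos[of "vs ! k" "vs ! i"]
          that sym[of "vs ! i" "vs ! k"] by simp
      have "(if adjacent G (vs ! j) (vs ! k) \<and> adjacent G (vs ! i) (vs ! k)
            then 1 / (?d k * sqrt (?d j * ?d i)) else 0) = 0
          \<longleftrightarrow> \<not> (adjacent G (vs ! j) (vs ! k) \<and> adjacent G (vs ! i) (vs ! k))" for k
        using pos[of k] by (metis less_irrefl)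
      then show ?thesis unfolding entry[OF that]
        by (subst sum_nonneg_eq_0_iff) (simp_all only: finite_lessThan lessThan_iff Ball_def, simp)
    qed
    also have "\<dots> \<longleftrightarrow> \<not> (\<exists>k \<in> pverts G. adjacent G (vs ! j) k \<and> adjacent G (vs ! i) k)"
      unfolding assms(5)[symmetric] n_def by (metis in_set_conv_nth)
    also have "\<dots> \<longleftrightarrow> \<not> (\<exists>k. adjacent G (vs ! j) k \<and> adjacent G (vs ! i) k)"
      using in_arcsD2 by auto
    finally show ?thesis .
  qed
  have "(\<forall>j<n. j \<noteq> i \<longrightarrow> (R * transpose_mat R) $$ (j, i) = 0)
      \<longleftrightarrow> (\<forall>j<n. j \<noteq> i \<longrightarrow> \<not> (\<exists>k. adjacent G (vs ! j) k \<and> adjacent G (vs ! i) k))"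
    using offdiag by blast
  also have "\<dots> \<longleftrightarrow> (\<forall>u \<in> pverts G - {vs ! i}. \<not> (\<exists>k. adjacent G u k \<and> adjacent G (vs ! i) k))"
  proof -
    have "pverts G - {vs ! i} = (\<lambda>j. vs ! j) ` {j. j < n \<and> j \<noteq> i}"
      unfolding assms(5)[symmetric] using i assms(4)
      by (auto simp: n_def in_set_conv_nth nth_eq_iff_index_eq)
    then show ?thesis by auto
  qed
  also have "\<dots> \<longleftrightarrow> star_graph G \<and> star_center G (vs ! i)"
    using star_iff_no_common_neighbour[OF assms(2,3)] nth_mem[OF assms(6)] assms(5) by simp
  finally have iff: "(\<forall>j<n. j \<noteq> i \<longrightarrow> (R * transpose_mat R) $$ (j, i) = 0)
      \<longleftrightarrow> star_graph G \<and> star_center G (vs ! i)" .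
  have energy: "randic_energy G vs i = mat_abs R $$ (i, i)"
    by (simp only: randic_energy_def R_def)
  show ?thesis
    using mat_abs_diagonal[OF R i, unfolded iff diag] unfolding energy n_def by (rule conjI)
qed

end
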